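(* Consider the Random Actions (RA) model with $N$ agents, parameter $\alpha\in(0,1)$ and a row-stochastic trust matrix $W$ (not necessarily irreducible). Suppose that a stubborn agent is present, that is, the poset of strongly connected components of the network has exactly one maximal element, this maximal element consists of a single agent $k$, and the initial opinion of this agent satisfies $x_{1,k}\in\{0,1\}$. Then the RA model converges to consensus almost surely: there is a random vector $\mathbf{x}_\infty$ with values in $\{\mathbf{0},\mathbf{1}\}$ (the all-zeros and all-ones vectors in $\mathbb{R}^N$) such that $\mathbf{x}_t\to\mathbf{x}_\infty$ almost surely as $t\to\infty$.
   Context: $\mathbb{N}=\{1,2,\dots\}$. Random Actions (RA) model: there are $N$ agents, a constant $\alpha\in(0,1)$, and an $N\times N$ row-stochastic matrix $W=(w_{ij})$ (nonnegative entries, each row sums to $1$); $w_{ij}>0$ is regarded as a directed edge from $j$ to $i$. The initial opinion vector $\mathbf{x}_1$ is a random vector in $[0,1]^N$ with arbitrary distribution (subject to any hypotheses in the claim). For each $t\in\mathbb{N}$, conditionally on the history $(\mathbf{x}_1,\mathbf{a}_1,\dots,\mathbf{a}_{t-1})$ (which determines $\mathbf{x}_t$), the actions $a_{t,1},\dots,a_{t,N}\in\{0,1\}$ are independent with $a_{t,i}\sim\mathrm{Bernoulli}(x_{t,i})$, and opinions are updated by $\mathbf{x}_{t+1}=(1-\alpha)\mathbf{x}_t+\alpha W\mathbf{a}_t$. Thus $\mathbf{x}_t\in[0,1]^N$ for all $t$. Components: two agents $i,j$ communicate if there is a directed path (possibly of length $0$) from $i$ to $j$ and one from $j$ to $i$.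 This is an equivalence relation; its classes $C_1,\dots,C_M$ are the strongly connected components. Write $C_r\preceq C_s$ if there is a directed path (possibly of length $0$) from an agent in $C_s$ to an agent in $C_r$. This is a partial order on $\{C_1,\dots,C_M\}$. A component $C_s$ is a maximal element if there is no $C_t\neq C_s$ with $C_s\preceq C_t$. *)

theory Defs
  imports "HOL-Probability.Probability"
begin

definition row_stochastic :: "real ^ 'n ^ 'n \<Rightarrow> bool" where
  "row_stochastic W \<longleftrightarrow> (\<forall>i j. 0 \<le> W $ i $ j) \<and> (\<forall>i. (\<Sum>j\<in>UNIV. W $ i $ j) = 1)"

text \<open>Edges point in the direction of influence: a positive weight of \<open>j\<close> in row \<open>i\<close> is an
  edge from \<open>j\<close> to \<open>i\<close>.\<close>

definition edges :: "real ^ 'n ^ 'n \<Rightarrow> ('n \<times> 'n) set" where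
  "edges W = {(j, i). W $ i $ j > 0}"

definition communicating :: "real ^ 'n ^ 'n \<Rightarrow> ('n \<times> 'n) set" where
  "communicating W = {(i, j). (i, j) \<in> (edges W)\<^sup>* \<and> (j, i) \<in> (edges W)\<^sup>*}"

definition components :: "real ^ 'n ^ 'n \<Rightarrow> 'n set set" where
  "components W = UNIV // communicating W"

definition component_le :: "real ^ 'n ^ 'n \<Rightarrow> 'n set \<Rightarrow> 'n set \<Rightarrow> bool" where
  "component_le W C D \<longleftrightarrow> (\<exists>i\<in>D. \<exists>j\<in>C. (i, j) \<in> (edges W)\<^sup>*)"

definition maximal_component :: "real ^ 'n ^ 'n \<Rightarrow> 'n set \<Rightarrow> bool" where
  "maximal_component W C \<longleftrightarrow>
     C \<in> components W \<and> \<not> (\<exists>D\<in>components W. D \<noteq> C \<and> component_le W C D)"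

definition cond_prob_wrt :: "'w measure \<Rightarrow> 'w measure \<Rightarrow> 'w set \<Rightarrow> 'w \<Rightarrow> real" where
  "cond_prob_wrt M F A = real_cond_exp M F (indicator A)"

text \<open>The conditional analogue of \<open>prob_space.indep_vars\<close>.\<close>

definition cond_indep_vars ::
  "'w measure \<Rightarrow> 'w measure \<Rightarrow> ('i \<Rightarrow> 'b measure) \<Rightarrow> ('i \<Rightarrow> 'w \<Rightarrow> 'b) \<Rightarrow> 'i set \<Rightarrow> bool" where
  "cond_indep_vars M F N X I \<longleftrightarrow>
     (\<forall>i\<in>I. X i \<in> measurable M (N i)) \<and>
     (\<forall>J A. J \<subseteq> I \<and> J \<noteq> {} \<and> finite J \<and> (\<forall>j\<in>J. A j \<in> sets (N j)) \<longrightarrow>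
        (AE \<omega> in M. cond_prob_wrt M F (\<Inter>j\<in>J. X j -` A j \<inter> space M) \<omega> =
                    (\<Prod>j\<in>J. cond_prob_wrt M F (X j -` A j \<inter> space M) \<omega>)))"

text \<open>The \<open>\<sigma>\<close>-algebra generated by the initial opinions \<open>x\<^sub>1\<close> and the actions \<open>a\<^sub>1, \<dots>, a\<^sub>t\<^sub>-\<^sub>1\<close>.\<close>

definition history ::
  "'w measure \<Rightarrow> ('w \<Rightarrow> real ^ 'n) \<Rightarrow> (nat \<Rightarrow> 'w \<Rightarrow> real ^ 'n) \<Rightarrow> nat \<Rightarrow> 'w measure" where
  "history M x1 a t = sigma (space M)
     ({x1 -` B \<inter> space M | B. B \<in> sets borel} \<union>
      {a s -` B \<inter> space M | s B. s \<in> {1..<t} \<and> B \<in> sets borel})"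

text \<open>Time starts at \<open>1\<close>; the values of \<open>x\<close> and \<open>a\<close> at time \<open>0\<close> are unconstrained.\<close>

locale random_actions = prob_space M
  for M :: "'w measure" +
  fixes \<alpha> :: real
    and W :: "real ^ 'n::finite ^ 'n"
    and x :: "nat \<Rightarrow> 'w \<Rightarrow> real ^ 'n"
    and a :: "nat \<Rightarrow> 'w \<Rightarrow> real ^ 'n"
  assumes alpha: "0 < \<alpha>" "\<alpha> < 1"
    and stochastic: "row_stochastic W"
    and initial_measurable: "x 1 \<in> borel_measurable M"
    and initial_range: "\<And>\<omega> i. \<omega> \<in> space M \<Longrightarrow> x 1 \<omega> $ i \<in> {0..1}"
    and action_measurable: "\<And>t. t \<ge> 1 \<Longrightarrow> a t \<in> borel_measurable M"
    and action_range: "\<And>t \<omega> i. t \<ge> 1 \<Longrightarrow> \<omega> \<in> space M \<Longrightarrow> a t \<omega> $ i \<in> {0, 1}"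
    and update: "\<And>t \<omega>. t \<ge> 1 \<Longrightarrow> \<omega> \<in> space M \<Longrightarrow>
      x (Suc t) \<omega> = (1 - \<alpha>) *\<^sub>R x t \<omega> + \<alpha> *\<^sub>R (W *v a t \<omega>)"
    and action_cond_indep: "\<And>t. t \<ge> 1 \<Longrightarrow>
      cond_indep_vars M (history M (x 1) a t) (\<lambda>_. borel) (\<lambda>i \<omega>. a t \<omega> $ i) UNIV"
    and action_cond_bernoulli: "\<And>t i. t \<ge> 1 \<Longrightarrow>
      AE \<omega> in M. cond_prob_wrt M (history M (x 1) a t) {\<omega> \<in> space M. a t \<omega> $ i = 1} \<omega> = x t \<omega> $ i"

lemma (in random_actions) subalgebra_history: "subalgebra M (history M (x 1) a t)"
proof -
  let ?G = "{x 1 -` B \<inter> space M | B. B \<in> sets borel} \<union>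
      {a s -` B \<inter> space M | s B. s \<in> {1..<t} \<and> B \<in> sets borel}"
  have "?G \<subseteq> sets M"
    using measurable_sets[OF initial_measurable] measurable_sets[OF action_measurable] by auto
  moreover have "?G \<subseteq> Pow (space M)" by auto
  ultimately show ?thesis
    unfolding subalgebra_def history_def by (simp add: sets.sigma_sets_subset)
qed

end

theory Submission
  imports Defs
begin

text \<open>Let \<open>c = x\<^sub>1\<^sub>,\<^sub>k\<close> and \<open>z\<^sub>t\<^sub>,\<^sub>i = c (1 - x\<^sub>t\<^sub>,\<^sub>i) + (1 - c) x\<^sub>t\<^sub>,\<^sub>i\<close>, which is \<open>\<bar>x\<^sub>t\<^sub>,\<^sub>i - c\<bar>\<close> when \<open>c\<close> is
  \<open>0\<close> or \<open>1\<close>. As \<open>c\<close> belongs to the history and \<open>z\<close> is affine in \<open>x\<^sub>t\<close>, the expectations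
  \<open>e\<^sub>t = E z\<^sub>t\<close> satisfy \<open>e\<^sub>t\<^sub>+\<^sub>1 = (1 - \<alpha>) e\<^sub>t + \<alpha> W e\<^sub>t\<close>. This averaging dynamics is pinned to
  \<open>0\<close> at \<open>k\<close>, from which every agent is reachable, so that \<open>\<Sum>\<^sub>t e\<^sub>t\<^sub>,\<^sub>i\<close> is finite for every \<open>i\<close>.
  Hence \<open>\<Sum>\<^sub>t z\<^sub>t\<^sub>,\<^sub>i\<close> is almost surely finite, and \<open>x\<^sub>t\<close> tends to \<open>c\<close> in every coordinate.\<close>

section \<open>Components and reachability in the network\<close>

lemma equiv_communicating: "equiv UNIV (communicating W)"
  unfolding communicating_def
  by (intro equivI refl_onI symI transI) (auto intro: rtrancl_trans)

text \<open>A positive weight of some \<open>j \<noteq> k\<close> in row \<open>k\<close> would put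
  the component of \<open>j\<close> above \<open>{k}\<close>. So agent \<open>k\<close> listens to
  itself only, and its opinion never moves.\<close>

lemma maximal_component_singleton_row:
  assumes "row_stochastic W" "maximal_component W {k}"
  shows "W $ k $ j = (if j = k then 1 else 0)"
proof -
  have zero: "W $ k $ j = 0" if "j \<noteq> k" for j
  proof (rule ccontr)
    assume "W $ k $ j \<noteq> 0"
    then have "(j, k) \<in> edges W"
      using assms(1) by (auto simp: edges_def row_stochastic_def less_le)
    moreover have self: "j \<in> communicating W `` {j}"
      by (auto simp: communicating_def)
    ultimately have "component_le W {k} (communicating W `` {j})"
      by (auto simp: component_le_def)
    moreover have "communicating W `` {j} \<in> components W"
      by (simp add: components_def quotientI)
    ultimately have "communicating W `` {j} = {k}"
      using assms(2) by (metis maximal_component_def)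
    then show False using self that by simp
  qed
  have "1 = (\<Sum>j\<in>UNIV. W $ k $ j)"
    using assms(1) by (simp add: row_stochastic_def)
  also have "\<dots> = (\<Sum>j\<in>UNIV. if j = k then W $ k $ k else 0)"
    by (intro sum.cong) (auto simp: zero)
  finally have "W $ k $ k = 1" by simp
  then show ?thesis by (simp add: zero)
qed

text \<open>Among the ancestors of \<open>i\<close>, take one with the fewest ancestors. Whatever
  reaches it has no more ancestors than it has, hence by minimality the same ones, hence
  communicates with it.\<close>

lemma reachable_from_maximal_component:
  fixes W :: "real ^ 'n::finite ^ 'n"
  obtains C j where "maximal_component W C" "j \<in> C" "(j, i) \<in> (edges W)\<^sup>*"
proof -
  define anc where "anc j = {l. (l, j) \<in> (edges W)\<^sup>*}" for j
  obtain j where j: "j \<in> anc i" and min: "\<And>l. l \<in> anc i \<Longrightarrow> card (anc j) \<le> card (anc l)"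
    using ex_has_least_nat[of "\<lambda>j. j \<in> anc i" i "\<lambda>j. card (anc j)"]
    by (auto simp: anc_def)
  let ?C = "communicating W `` {j}"
  have "D = ?C" if D: "D \<in> components W" "component_le W ?C D" for D
  proof -
    obtain p q where pq: "p \<in> D" "(j, q) \<in> communicating W" "(p, q) \<in> (edges W)\<^sup>*"
      using D(2) by (auto simp: component_le_def)
    then have pj: "(p, j) \<in> (edges W)\<^sup>*"
      by (auto simp: communicating_def intro: rtrancl_trans)
    then have "anc p \<subseteq> anc j" "p \<in> anc i"
      using j by (auto simp: anc_def intro: rtrancl_trans)
    then have "anc p = anc j"
      using min by (intro card_seteq) auto
    \<comment> \<open>The path back from \<open>j\<close> to \<open>p\<close> comes from
      \<open>j \<in> anc j = anc p\<close>.\<close>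
    then have "(p, j) \<in> communicating W"
      using pj by (auto simp: communicating_def anc_def)
    moreover have "D = communicating W `` {p}"
      using D(1) pq(1) equiv_communicating[of W]
      unfolding components_def by (metis Image_singleton_iff equiv_class_eq quotientE)
    ultimately show ?thesis
      using equiv_communicating equiv_class_eq by metis
  qed
  then have "maximal_component W ?C"
    by (auto simp: maximal_component_def components_def quotient_def)
  moreover have "j \<in> ?C" by (auto simp: communicating_def)
  ultimately show ?thesis using that j by (auto simp: anc_def)
qed

section \<open>Averaging dynamics pinned at one vertex\<close>

text \<open>Up to a bounded error, each partial sum \<open>s n i\<close> is at most the
  \<open>W\<close>-average of the partial sums. Their maximum \<open>m n\<close> therefore cannot
  grow without bound: a path from \<open>k\<close>, where the sums vanish, pulls every vertex a
  fixed fraction below \<open>m n\<close>.\<close>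

lemma summable_averaging:
  fixes W :: "real ^ 'n::finite ^ 'n" and e :: "nat \<Rightarrow> 'n \<Rightarrow> real"
  assumes "0 < \<alpha>" and W: "row_stochastic W"
    and nonneg: "\<And>t i. 0 \<le> e t i"
    and pinned: "\<And>t. e t k = 0"
    and step: "\<And>t i. e (Suc t) i = (1 - \<alpha>) * e t i + \<alpha> * (\<Sum>j\<in>UNIV. W $ i $ j * e t j)"
    and reach: "\<And>i. (k, i) \<in> (edges W)\<^sup>*"
  shows "summable (\<lambda>t. e t i)"
proof -
  define s where "s n i = (\<Sum>t<n. e t i)" for n i
  define m where "m n = Max (range (s n))" for n
  define B where "B i = e 0 i / \<alpha>" for i
  have w0: "0 \<le> W $ i $ j" and w1: "(\<Sum>j\<in>UNIV. W $ i $ j) = 1" for i j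
    using W by (auto simp: row_stochastic_def)
  have s_le: "s n i \<le> m n" for n i
    unfolding m_def by (intro Max_ge) auto
  have s0: "0 \<le> s n i" for n i
    unfolding s_def by (intro sum_nonneg nonneg)
  have B0: "0 \<le> B i" for i
    unfolding B_def using nonneg \<open>0 < \<alpha>\<close> by simp
  \<comment> \<open>Sum of the increments \<open>e (Suc t) i - e t i\<close>, which are \<alpha>
    times the average of \<open>e t\<close> minus \<open>e t i\<close>. Dropping
    \<open>e n i \<ge> 0\<close> and dividing by \<alpha> then gives the error
    \<open>B i\<close>.\<close>
  have telescope: "\<alpha> * s n i + e n i = \<alpha> * (\<Sum>j\<in>UNIV. W $ i $ j * s n j) + e 0 i" for n i
  proof (induction n)
    case 0
    then show ?case by (simp add: s_def)
  next
    case (Suc n)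
    have "(\<Sum>j\<in>UNIV. W $ i $ j * s (Suc n) j)
        = (\<Sum>j\<in>UNIV. W $ i $ j * s n j) + (\<Sum>j\<in>UNIV. W $ i $ j * e n j)"
      by (simp add: s_def sum.distrib algebra_simps)
    moreover have "s (Suc n) i = s n i + e n i" by (simp add: s_def)
    ultimately show ?case using Suc step[of n i] by (simp add: algebra_simps)
  qed
  have potential: "s n i \<le> (\<Sum>j\<in>UNIV. W $ i $ j * s n j) + B i" for n i
  proof -
    have "\<alpha> * s n i \<le> \<alpha> * ((\<Sum>j\<in>UNIV. W $ i $ j * s n j) + B i)"
      using telescope[of n i] nonneg[of n i] \<open>0 < \<alpha>\<close> by (simp add: B_def algebra_simps)
    then show ?thesis using \<open>0 < \<alpha>\<close> by simp
  qed
  \<comment> \<open>It matters that \<delta> and \<open>C\<close> do not depend on \<open>n\<close>.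
    They are built along a path from \<open>k\<close>, starting with \<delta> = 1 because
    \<open>s n k = 0\<close>.\<close>
  have "\<exists>\<delta> C. 0 < \<delta> \<and> 0 \<le> C \<and> (\<forall>n. s n i \<le> (1 - \<delta>) * m n + C)" for i
    using reach[of i]
  proof (induction rule: rtrancl_induct)
    case base
    show ?case by (rule exI[of _ 1]) (auto simp: s_def pinned)
  next
    case (step j i)
    then obtain \<delta> C where \<delta>: "0 < \<delta>" "0 \<le> C" and IH: "\<And>n. s n j \<le> (1 - \<delta>) * m n + C"
      by auto
    define w where "w = W $ i $ j"
    have w: "0 < w" using step(2) by (simp add: edges_def w_def)
    \<comment> \<open>The neighbour \<open>j\<close> contributes its gain with weight
      \<open>w\<close>; all other neighbours are bounded by \<open>m n\<close>.\<close>
    have "s n i \<le> (1 - w * \<delta>) * m n + (w * C + B i)" for n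
    proof -
      have "(\<Sum>l\<in>UNIV. W $ i $ l * s n l) = w * s n j + (\<Sum>l\<in>UNIV - {j}. W $ i $ l * s n l)"
        unfolding w_def by (rule sum.remove) auto
      also have "\<dots> \<le> w * ((1 - \<delta>) * m n + C) + (\<Sum>l\<in>UNIV - {j}. W $ i $ l * m n)"
        using w by (intro add_mono mult_left_mono sum_mono IH s_le w0) auto
      also have "(\<Sum>l\<in>UNIV - {j}. W $ i $ l * m n) = (1 - w) * m n"
        using sum.remove[of UNIV j "\<lambda>l. W $ i $ l"] w1[of i]
        by (simp add: w_def sum_distrib_right[symmetric])
      finally show ?thesis using potential[of n i] by (simp add: algebra_simps)
    qed
    moreover have "0 < w * \<delta>" "0 \<le> w * C + B i"
      using w \<delta> B0 by auto
    ultimately show ?case by blast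
  qed
  then obtain \<delta> C where \<delta>: "\<And>i. 0 < \<delta> i" and C: "\<And>i. 0 \<le> C i"
    and bound: "\<And>i n. s n i \<le> (1 - \<delta> i) * m n + C i"
    by metis
  \<comment> \<open>At a vertex attaining the maximum, \<open>bound\<close> reads
    \<open>\<delta> j * m n \<le> C j\<close>. That vertex varies with \<open>n\<close>, so the sum
    over all vertices serves as a uniform bound.\<close>
  have m_le: "m n \<le> (\<Sum>j\<in>UNIV. C j / \<delta> j)" for n
  proof -
    have "m n \<in> range (s n)" unfolding m_def by (intro Max_in) auto
    then obtain j where "m n = s n j" by auto
    then have "\<delta> j * m n \<le> C j"
      using bound[of n j] by (simp add: algebra_simps)
    then have "m n \<le> C j / \<delta> j"
      using \<delta>[of j] by (simp add: field_simps)
    also have "\<dots> \<le> (\<Sum>j\<in>UNIV. C j / \<delta> j)"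
      using \<delta> C by (intro member_le_sum) (auto simp: less_imp_le)
    finally show ?thesis .
  qed
  show ?thesis
  proof (rule summableI_nonneg_bounded)
    show "(\<Sum>t<n. e t i) \<le> (\<Sum>j\<in>UNIV. C j / \<delta> j)" for n
      using s_le[of n i] m_le[of n] by (simp add: s_def)
  qed (rule nonneg)
qed

section \<open>From summable expectations to almost sure convergence\<close>

text \<open>By monotone convergence the series of the \<open>f n\<close> has finite integral, so it
  converges almost everywhere and its terms vanish in the limit.\<close>

lemma AE_tendsto_zero_if_summable_integral:
  fixes f :: "nat \<Rightarrow> 'a \<Rightarrow> real"
  assumes int: "\<And>n. integrable M (f n)"
    and nonneg: "\<And>n x. x \<in> space M \<Longrightarrow> 0 \<le> f n x"
    and summable: "summable (\<lambda>n. integral\<^sup>L M (f n))"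
  shows "AE x in M. (\<lambda>n. f n x) \<longlonglongrightarrow> 0"
proof -
  have [measurable]: "f n \<in> borel_measurable M" for n
    using int by auto
  have "(\<integral>\<^sup>+x. (\<Sum>n. ennreal (f n x)) \<partial>M) = (\<Sum>n. \<integral>\<^sup>+x. ennreal (f n x) \<partial>M)"
    by (rule nn_integral_suminf) simp
  also have "\<dots> = (\<Sum>n. ennreal (integral\<^sup>L M (f n)))"
    using int nonneg by (intro suminf_cong nn_integral_eq_integral) auto
  also have "\<dots> = ennreal (\<Sum>n. integral\<^sup>L M (f n))"
    using nonneg summable by (intro suminf_ennreal2 integral_nonneg) auto
  finally have "AE x in M. (\<Sum>n. ennreal (f n x)) \<noteq> \<infinity>"
    by (intro nn_integral_PInf_AE) auto
  then show ?thesis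
  proof (rule AE_mp, intro AE_I2 impI)
    fix x assume "x \<in> space M" "(\<Sum>n. ennreal (f n x)) \<noteq> \<infinity>"
    then have "summable (\<lambda>n. f n x)"
      by (intro summable_suminf_not_top) (auto simp: nonneg)
    then show "(\<lambda>n. f n x) \<longlonglongrightarrow> 0" by (rule summable_LIMSEQ_zero)
  qed
qed

section \<open>Measurability, range and conditional means in the RA model\<close>

lemma borel_measurable_vec_nth_compose [measurable (raw)]:
  fixes f :: "'a \<Rightarrow> real ^ 'n::finite"
  assumes "f \<in> borel_measurable M"
  shows "(\<lambda>\<omega>. f \<omega> $ i) \<in> borel_measurable M"
  using measurable_compose[OF assms borel_measurable_nth] .

context random_actions
begin

lemma update_nth:
  assumes "t \<ge> 1" "\<omega> \<in> space M"
  shows "x (Suc t) \<omega> $ i = (1 - \<alpha>) * x t \<omega> $ i + \<alpha> * (\<Sum>j\<in>UNIV. W $ i $ j * a t \<omega> $ j)"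
  using update[OF assms] by (simp add: matrix_vector_mult_def)

lemma opinion_measurable:
  assumes "t \<ge> 1"
  shows "x t \<in> borel_measurable M"
  using assms
proof (induction t rule: dec_induct)
  case base
  show ?case by (rule initial_measurable)
next
  case (step t)
  have [measurable]: "x t \<in> borel_measurable M" "a t \<in> borel_measurable M"
    using step action_measurable by auto
  have "continuous_on UNIV ((*v) W)"
    by (intro linear_continuous_on matrix_vector_mul_bounded_linear)
  then have "(*v) W \<in> borel_measurable borel"
    by (rule borel_measurable_continuous_onI)
  from measurable_compose[OF _ this, of "a t" M]
  have [measurable]: "(\<lambda>\<omega>. W *v a t \<omega>) \<in> borel_measurable M"
    by measurable
  have "(\<lambda>\<omega>. (1 - \<alpha>) *\<^sub>R x t \<omega> + \<alpha> *\<^sub>R (W *v a t \<omega>)) \<in> borel_measurable M"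
    by measurable
  then show ?case
    using step.hyps update by (subst measurable_cong) auto
qed

lemma opinion_range:
  assumes "t \<ge> 1" "\<omega> \<in> space M"
  shows "0 \<le> x t \<omega> $ i" "x t \<omega> $ i \<le> 1"
proof -
  have "\<forall>i. 0 \<le> x t \<omega> $ i \<and> x t \<omega> $ i \<le> 1"
    using assms(1)
  proof (induction t rule: dec_induct)
    case base
    show ?case using initial_range[OF assms(2)] by simp
  next
    case (step t)
    show ?case
    proof
      fix i
      let ?s = "\<Sum>j\<in>UNIV. W $ i $ j * a t \<omega> $ j"
      have w: "0 \<le> W $ i $ j" "(\<Sum>j\<in>UNIV. W $ i $ j) = 1" for j
        using stochastic by (auto simp: row_stochastic_def)
      have a: "0 \<le> a t \<omega> $ j" "a t \<omega> $ j \<le> 1" for j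
        using action_range[OF step.hyps(1) assms(2), of j] by auto
      have "0 \<le> ?s" using w a by (intro sum_nonneg) auto
      moreover have "?s \<le> (\<Sum>j\<in>UNIV. W $ i $ j)"
        using w a by (intro sum_mono) (auto intro: mult_left_le)
      ultimately have s: "0 \<le> ?s" "?s \<le> 1" using w by auto
      have "(1 - \<alpha>) * x t \<omega> $ i + \<alpha> * ?s \<le> 1"
        using s step.IH alpha by (intro convex_bound_le) auto
      then show "0 \<le> x (Suc t) \<omega> $ i \<and> x (Suc t) \<omega> $ i \<le> 1"
        using s step.IH alpha update_nth[OF step.hyps(1) assms(2)] by simp
    qed
  qed
  then show "0 \<le> x t \<omega> $ i" "x t \<omega> $ i \<le> 1" by auto
qed

lemma initial_measurable_history:
  "x 1 \<in> borel_measurable (history M (x 1) a t)"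
proof (rule measurableI)
  fix B :: "(real ^ 'n) set" assume "B \<in> sets borel"
  moreover have "space (history M (x 1) a t) = space M"
    using subalgebra_history by (simp add: subalgebra_def)
  ultimately show "x 1 -` B \<inter> space (history M (x 1) a t) \<in> sets (history M (x 1) a t)"
    unfolding history_def by (subst sets_measure_of) (auto intro!: sigma_sets.Basic)
qed auto

text \<open>A 0/1-valued action is the indicator of the event that it equals 1. Its conditional
  probability given the history is the opinion, and a factor measurable in the history passes
  through the conditioning.\<close>

lemma expectation_mult_action:
  fixes g :: "'w \<Rightarrow> real"
  assumes t: "t \<ge> 1"
    and g: "g \<in> borel_measurable (history M (x 1) a t)"
    and bounded: "\<And>\<omega>. \<omega> \<in> space M \<Longrightarrow> \<bar>g \<omega>\<bar> \<le> B"
  shows "expectation (\<lambda>\<omega>. g \<omega> * a t \<omega> $ i) = expectation (\<lambda>\<omega>. g \<omega> * x t \<omega> $ i)"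
proof -
  let ?F = "history M (x 1) a t"
  let ?A = "{\<omega> \<in> space M. a t \<omega> $ i = 1}"
  interpret finite_measure_subalgebra M ?F
    using subalgebra_history by unfold_locales
  have [measurable]: "a t \<in> borel_measurable M" "x t \<in> borel_measurable M"
    using t by (auto intro: action_measurable opinion_measurable)
  have [measurable]: "g \<in> borel_measurable M"
    using g subalgebra_history measurable_from_subalg by blast
  have "expectation (\<lambda>\<omega>. g \<omega> * a t \<omega> $ i) = expectation (\<lambda>\<omega>. g \<omega> * indicator ?A \<omega>)"
    using action_range[OF t, of _ i] by (intro Bochner_Integration.integral_cong) (auto simp: indicator_def)
  also have "\<dots> = expectation (\<lambda>\<omega>. g \<omega> * real_cond_exp M ?F (indicator ?A) \<omega>)"
  proof (rule real_cond_exp_intg(2)[symmetric])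
    show "integrable M (\<lambda>\<omega>. g \<omega> * indicator ?A \<omega>)"
      by (intro integrable_const_bound[of _ "\<bar>B\<bar>"])
         (auto simp: indicator_def intro: order_trans[OF bounded abs_ge_self])
  qed (use g in measurable)
  also have "\<dots> = expectation (\<lambda>\<omega>. g \<omega> * x t \<omega> $ i)"
    using action_cond_bernoulli[OF t, of i]
    by (intro integral_cong_AE) (auto simp: cond_prob_wrt_def)
  finally show ?thesis .
qed

end

section \<open>Convergence to consensus\<close>

theorem corollary1:
  fixes M :: "'w measure"
    and \<alpha> :: real
    and W :: "real ^ 'n::finite ^ 'n"
    and x a :: "nat \<Rightarrow> 'w \<Rightarrow> real ^ 'n"
    and k :: 'n
  assumes "random_actions M \<alpha> W x a"
    and "\<exists>!C. maximal_component W C"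
    and "maximal_component W {k}"
    and "AE \<omega> in M. x 1 \<omega> $ k \<in> {0, 1}"
  shows "\<exists>x_inf. x_inf \<in> borel_measurable M \<and>
           (\<forall>\<omega>\<in>space M. x_inf \<omega> \<in> {vec 0, vec 1}) \<and>
           (AE \<omega> in M. (\<lambda>t. x t \<omega>) \<longlonglongrightarrow> x_inf \<omega>)"
proof -
  interpret random_actions M \<alpha> W x a by fact
  define c where "c \<omega> = x 1 \<omega> $ k" for \<omega>
  \<comment> \<open>This form isolates the factor \<open>1 - 2 * c \<omega>\<close>, known from the
    history, in front of the opinion.\<close>
  define z where "z t i \<omega> = c \<omega> + (1 - 2 * c \<omega>) * x t \<omega> $ i" for t i \<omega>
  \<comment> \<open>The shift by one is due to time starting at 1: \<open>x 0\<close> is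
    arbitrary.\<close>
  define e where "e t i = expectation (z (Suc t) i)" for t i
  have c: "0 \<le> c \<omega>" "c \<omega> \<le> 1" if "\<omega> \<in> space M" for \<omega>
    using opinion_range[OF _ that] by (auto simp: c_def)
  have [measurable]: "c \<in> borel_measurable M"
    unfolding c_def using initial_measurable by (rule borel_measurable_vec_nth_compose)
  have [measurable]: "x (Suc t) \<in> borel_measurable M" "a (Suc t) \<in> borel_measurable M" for t
    by (auto intro: opinion_measurable action_measurable)
  \<comment> \<open>Nonnegativity is needed on the whole space, whereas \<open>c\<close> is 0 or 1
    only almost surely; the convex combination gives it for all \<open>c\<close> in [0,1].\<close>
  have z0: "0 \<le> z (Suc t) i \<omega>" if "\<omega> \<in> space M" for t i \<omega>
  proof -
    have "z (Suc t) i \<omega> = c \<omega> * (1 - x (Suc t) \<omega> $ i) + (1 - c \<omega>) * x (Suc t) \<omega> $ i"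
      by (simp add: z_def algebra_simps)
    then show ?thesis
      using c[OF that] opinion_range[OF _ that, of "Suc t" i] by simp
  qed
  have g_bound: "\<bar>1 - 2 * c \<omega>\<bar> \<le> 1" if "\<omega> \<in> space M" for \<omega>
    using c[OF that] by auto
  have int_c: "integrable M c"
    using c by (intro integrable_const_bound[of _ 1]) auto
  have int_x: "integrable M (\<lambda>\<omega>. (1 - 2 * c \<omega>) * x (Suc t) \<omega> $ i)" for t i
    using g_bound opinion_range[of "Suc t" _ i]
    by (intro integrable_const_bound[of _ 1]) (auto simp: abs_mult intro!: mult_le_one)
  have int_a: "integrable M (\<lambda>\<omega>. (1 - 2 * c \<omega>) * a (Suc t) \<omega> $ i)" for t i
  proof (intro integrable_const_bound[of _ 1] AE_I2)
    fix \<omega> assume \<omega>: "\<omega> \<in> space M"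
    show "norm ((1 - 2 * c \<omega>) * a (Suc t) \<omega> $ i) \<le> 1"
      using g_bound[OF \<omega>] action_range[OF _ \<omega>, of "Suc t" i] by auto
  qed measurable
  have int_z: "integrable M (z (Suc t) i)" for t i
    unfolding z_def using int_c int_x by (intro Bochner_Integration.integrable_add) auto
  have e_eq: "e t i = expectation c + expectation (\<lambda>\<omega>. (1 - 2 * c \<omega>) * x (Suc t) \<omega> $ i)" for t i
    unfolding e_def z_def using int_c int_x by (rule Bochner_Integration.integral_add)
  have w1: "(\<Sum>j\<in>UNIV. W $ i $ j) = 1" for i
    using stochastic by (simp add: row_stochastic_def)
  have mean: "expectation (\<lambda>\<omega>. (1 - 2 * c \<omega>) * a (Suc t) \<omega> $ i)
      = expectation (\<lambda>\<omega>. (1 - 2 * c \<omega>) * x (Suc t) \<omega> $ i)" for t i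
  proof (rule expectation_mult_action[where B = 1])
    have [measurable]: "c \<in> borel_measurable (history M (x 1) a (Suc t))"
      unfolding c_def using initial_measurable_history by (rule borel_measurable_vec_nth_compose)
    show "(\<lambda>\<omega>. 1 - 2 * c \<omega>) \<in> borel_measurable (history M (x 1) a (Suc t))"
      by measurable
  qed (use g_bound in auto)
  have step: "e (Suc t) i = (1 - \<alpha>) * e t i + \<alpha> * (\<Sum>j\<in>UNIV. W $ i $ j * e t j)" for t i
  proof -
    let ?g = "\<lambda>\<omega>. 1 - 2 * c \<omega>"
    have "expectation (\<lambda>\<omega>. ?g \<omega> * x (Suc (Suc t)) \<omega> $ i)
        = expectation (\<lambda>\<omega>. (1 - \<alpha>) * (?g \<omega> * x (Suc t) \<omega> $ i)
            + \<alpha> * (\<Sum>j\<in>UNIV. W $ i $ j * (?g \<omega> * a (Suc t) \<omega> $ j)))"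
      by (intro Bochner_Integration.integral_cong)
         (simp_all add: update_nth algebra_simps sum_distrib_left)
    also have "\<dots> = (1 - \<alpha>) * expectation (\<lambda>\<omega>. ?g \<omega> * x (Suc t) \<omega> $ i)
            + \<alpha> * (\<Sum>j\<in>UNIV. W $ i $ j * expectation (\<lambda>\<omega>. ?g \<omega> * a (Suc t) \<omega> $ j))"
      using int_x int_a by (simp add: Bochner_Integration.integral_add Bochner_Integration.integral_sum)
    \<comment> \<open>The constant part \<open>expectation c\<close> of \<open>e\<close> is
      reproduced by the averaging because row \<open>i\<close> sums to 1.\<close>
    finally show ?thesis
      using w1[of i]
      by (simp add: e_eq mean distrib_left sum.distrib sum_distrib_right[symmetric])
         (simp add: algebra_simps)
  qed
  have e_k: "e t k = 0" for t
  proof (induction t)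
    case 0
    \<comment> \<open>At time 1, \<open>z\<close> at \<open>k\<close> equals
      \<open>2 * c * (1 - c)\<close>, which vanishes for \<open>c\<close> in {0,1}.\<close>
    have "e 0 k = expectation (\<lambda>\<omega>. 0)"
      unfolding e_def z_def c_def using assms(4) initial_measurable
      by (intro integral_cong_AE) (auto elim!: AE_mp simp flip: One_nat_def)
    then show ?case by simp
  next
    case (Suc t)
    then show ?case
      by (simp add: step maximal_component_singleton_row[OF stochastic assms(3)] if_distrib
          if_distribR cong: if_cong)
  qed
  \<comment> \<open>The maximal component above \<open>i\<close> is \<open>{k}\<close> by
    uniqueness.\<close>
  have reach: "(k, i) \<in> (edges W)\<^sup>*" for i
    using reachable_from_maximal_component[of W i] assms(2,3) by (metis singletonD)
  have "summable (\<lambda>t. e t i)" for i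
    using alpha(1) stochastic _ e_k step reach
    by (rule summable_averaging) (auto simp: e_def intro!: Bochner_Integration.integral_nonneg z0)
  then have "AE \<omega> in M. (\<lambda>t. z (Suc t) i \<omega>) \<longlonglongrightarrow> 0" for i
    unfolding e_def by (intro AE_tendsto_zero_if_summable_integral int_z z0)
  then have lim_z: "AE \<omega> in M. \<forall>i. (\<lambda>t. z (Suc t) i \<omega>) \<longlonglongrightarrow> 0"
    by (simp add: AE_all_countable)
  \<comment> \<open>The value \<open>vec 0\<close> also covers the null set where \<open>c\<close>
    is neither 0 nor 1, so that the range condition holds everywhere.\<close>
  define x_inf :: "'w \<Rightarrow> real ^ 'n" where "x_inf \<omega> = (if c \<omega> = 1 then vec 1 else vec 0)" for \<omega>
  have "AE \<omega> in M. (\<lambda>t. x t \<omega>) \<longlonglongrightarrow> x_inf \<omega>"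
    using lim_z assms(4)
  proof eventually_elim
    case (elim \<omega>)
    show ?case
    proof (rule LIMSEQ_imp_Suc, rule vec_tendstoI)
      fix i
      have "(\<lambda>t. z (Suc t) i \<omega>) \<longlonglongrightarrow> 0" using elim by blast
      \<comment> \<open>Both limits are supplied: the opinion is \<open>1 - z\<close> when
        \<open>c\<close> is 1, and \<open>z\<close> when \<open>c\<close> is 0.\<close>
      from tendsto_diff[OF tendsto_const[of 1] this] this
      show "(\<lambda>t. x (Suc t) \<omega> $ i) \<longlonglongrightarrow> x_inf \<omega> $ i"
        using elim(2) by (auto simp: z_def x_inf_def c_def)
    qed
  qed
  moreover have "x_inf \<in> borel_measurable M"
    unfolding x_inf_def by measurable
  moreover have "\<forall>\<omega>\<in>space M. x_inf \<omega> \<in> {vec 0, vec 1}"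
    by (simp add: x_inf_def)
  ultimately show ?thesis by blast
qed

end
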